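(* Let $d\ge1$ and $1<p<\infty$. There exists a constant $c(d,p)>0$ depending only on $d$ and $p$ such that, for all real numbers $n_1,\dots,n_d\ge1$ and every bounded convex polyhedron $P$ in $\mathbb{R}^d$ with $[0,n_1]\times\dots\times[0,n_d]\subset P\subset\mathbb{R}_+^d$, $$c(d,p)\prod_{j=1}^d(n_j+1)^{1-\frac1p}\le\mathcal{L}(P)_p.$$
   Context: $\mathbb{R}_+^d$ is the set of vectors in $\mathbb{R}^d$ with nonnegative coordinates. For a bounded set $W\subset\mathbb{R}^d$ the $L_p$ Lebesgue constant is $$\mathcal{L}(W)_p=\left(\frac{1}{(2\pi)^d}\int_{\mathbb{T}^d}\bigg|\sum_{\bm{k}\in W\cap\mathbb{Z}^d}e^{i(\bm{k},\bm{x})}\bigg|^p\,d\bm{x}\right)^{1/p},\qquad \mathbb{T}^d\simeq(-\pi,\pi]^d,$$ where $(\bm{k},\bm{x})=k_1x_1+\dots+k_dx_d$. *)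

theory Defs
  imports "HOL-Analysis.Analysis"
begin

definition nonneg_orthant :: "(real ^ 'd) set" where
  "nonneg_orthant = {x. \<forall>i. 0 \<le> x $ i}"

definition integer_lattice :: "(real ^ 'd) set" where
  "integer_lattice = {k. \<forall>i. k $ i \<in> \<int>}"

definition torus :: "(real ^ 'd) set" where
  "torus = {x. \<forall>i. - pi < x $ i \<and> x $ i \<le> pi}"

definition dirichlet_kernel :: "(real ^ 'd::finite) set \<Rightarrow> real ^ 'd \<Rightarrow> complex" where
  "dirichlet_kernel W x = (\<Sum>k \<in> W \<inter> integer_lattice. exp (\<i> * complex_of_real (k \<bullet> x)))"

text \<open>The index set of the sum is finite only for bounded \<open>W\<close>; for other \<open>W\<close> the value below
  carries no meaning. The integrand is continuous then, so the integral exists.\<close>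

definition lebesgue_constant :: "real \<Rightarrow> (real ^ 'd::finite) set \<Rightarrow> real" where
  "lebesgue_constant p W =
     (1 / (2 * pi) ^ CARD('d) *
        (LINT x:torus|lborel. norm (dirichlet_kernel W x) powr p)) powr (1 / p)"

end

theory Submission
  imports Defs
begin

text \<open>
  The bound is a duality argument. Let \<open>H\<close> be the set of lattice points of the half-size box
  \<open>[0, n\<^sub>1/2] \<times> \<dots> \<times> [0, n\<^sub>d/2]\<close>, and write \<open>M\<close> for its cardinality, \<open>h\<close> for its Dirichlet kernel and
  \<open>D\<close> for that of \<open>P\<close>. Every sum of two points of \<open>H\<close> lies in the full box, hence in \<open>P\<close>, so every
  frequency of \<open>h\<^sup>2\<close> has coefficient 1 in \<open>D\<close>, and orthogonality of the characters gives (integrals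
  being normalised by \<open>(2 \<pi>)\<^sup>d\<close>)
  \<open>\<integral> D \<cdot> cnj (h\<^sup>2) = M\<^sup>2\<close> and \<open>\<integral> \<bar>h\<bar>\<^sup>2 = M\<close>.

  Thus \<open>\<bar>h\<bar>\<^sup>2 / M\<close> is a probability density under which \<open>\<bar>D\<bar>\<close> has mean at least \<open>M\<close>. By Jensen's
  inequality the mean of \<open>\<bar>D\<bar>\<^sup>p\<close> is at least \<open>M\<^sup>p\<close>; since \<open>\<bar>h\<bar> \<le> M\<close>, the density never exceeds \<open>M\<close>, and so
  \<open>\<integral> \<bar>D\<bar>\<^sup>p \<ge> M powr (p - 1)\<close>. This is \<open>lebesgue_constant_ge_card_powr\<close>. The theorem follows because
  \<open>M = (\<Prod>j. \<lfloor>n\<^sub>j/2\<rfloor> + 1)\<close> is at least \<open>(\<Prod>j. (n\<^sub>j + 1) / 4)\<close>.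
\<close>

section \<open>Characters on the torus\<close>

lemma integral_circle_character:
  fixes k :: real
  assumes "k \<in> \<int>"
  shows "(LINT t:{-pi<..pi}|lborel. exp (\<i> * complex_of_real (k * t))) =
    (if k = 0 then complex_of_real (2 * pi) else 0)"
proof -
  have "(LINT t:{-pi<..pi}|lborel. exp (\<i> * complex_of_real (k * t))) =
      (\<integral>t. indicator {-pi..pi} t *\<^sub>R exp (\<i> * complex_of_real (k * t)) \<partial>lborel)"
    unfolding set_lebesgue_integral_def
  proof (rule integral_cong_AE)
    show "AE t in lborel. indicator {-pi<..pi} t *\<^sub>R exp (\<i> * complex_of_real (k * t)) =
        indicator {-pi..pi} t *\<^sub>R exp (\<i> * complex_of_real (k * t))"
      using AE_lborel_singleton[of "-pi"] by eventually_elim (auto simp: indicator_def)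
  qed measurable
  also have "\<dots> = (if k = 0 then complex_of_real (2 * pi) else 0)"
  proof (cases "k = 0")
    case True
    then show ?thesis
      by (simp add: scaleR_conv_of_real)
  next
    case False
    let ?F = "\<lambda>t. exp (\<i> * complex_of_real (k * t)) / (\<i> * complex_of_real k)"
    have "(\<integral>t. indicator {-pi..pi} t *\<^sub>R exp (\<i> * complex_of_real (k * t)) \<partial>lborel) =
        ?F pi - ?F (-pi)"
    proof (rule integral_FTC_atLeastAtMost)
      fix t :: real
      have "((\<lambda>z. exp (\<i> * (complex_of_real k * z)) / (\<i> * complex_of_real k))
          has_field_derivative exp (\<i> * (complex_of_real k * complex_of_real t))) (at (complex_of_real t))"
        using False by (auto intro!: derivative_eq_intros simp: field_simps)
      from has_vector_derivative_real_field[OF this]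
      show "(?F has_vector_derivative exp (\<i> * complex_of_real (k * t))) (at t within {-pi..pi})"
        by simp
    qed (auto intro!: continuous_intros)
    also have "\<dots> = 0"
    proof -
      have "exp (\<i> * complex_of_real (k * pi)) =
          exp (\<i> * complex_of_real (k * (-pi)) + complex_of_real (2 * k * pi) * \<i>)"
        by (simp add: algebra_simps)
      also have "\<dots> = exp (\<i> * complex_of_real (k * (-pi)))"
        by (simp only: exp_add exp_integer_2pi[OF assms] mult_1_right)
      finally show ?thesis by simp
    qed
    finally show ?thesis using False by simp
  qed
  finally show ?thesis .
qed

text \<open>
  Fubini's theorem for functions with separated variables. Lebesgue measure is by definition the
  image of a product measure indexed by the standard basis vectors, so the proof only reindexes
  the factors along \<open>i \<mapsto> axis i 1\<close>.
\<close>

lemma lborel_integral_prod_components: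
  fixes f :: "'d::finite \<Rightarrow> real \<Rightarrow> complex"
  assumes "\<And>i. integrable lborel (f i)"
  shows "(\<integral>x. (\<Prod>i\<in>UNIV. f i (x $ i)) \<partial>(lborel :: (real ^ 'd) measure)) =
    (\<Prod>i\<in>UNIV. integral\<^sup>L lborel (f i))"
proof -
  let ?ax = "\<lambda>i::'d. axis i (1::real)"
  let ?g = "\<lambda>b. f (inv ?ax b)"
  have inj: "inj ?ax" by (auto simp: inj_on_def axis_eq_axis)
  have Basis: "(Basis :: (real ^ 'd) set) = range ?ax"
    by (auto simp: Basis_vec_def)
  have [measurable]: "\<And>i. f i \<in> borel_measurable borel"
    using assms borel_measurable_integrable by fastforce
  interpret product_sigma_finite "\<lambda>b::real ^ 'd. lborel :: real measure" ..
  have comp: "(\<Sum>b\<in>Basis. y b *\<^sub>R b) $ i = y (?ax i)" for y :: "real ^ 'd \<Rightarrow> real" and i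
    unfolding cart_eq_inner_axis by (rule inner_sum_left_Basis) simp
  have "(\<integral>x. (\<Prod>i\<in>UNIV. f i (x $ i)) \<partial>(lborel :: (real ^ 'd) measure)) =
      (\<integral>y. (\<Prod>i\<in>UNIV. f i ((\<Sum>b\<in>Basis. y b *\<^sub>R b) $ i)) \<partial>(\<Pi>\<^sub>M b\<in>(Basis :: (real ^ 'd) set). lborel))"
    by (subst lborel_eq, subst integral_distr) (auto intro!: borel_measurable_prod)
  also have "\<dots> = (\<integral>y. (\<Prod>b\<in>Basis. ?g b (y b)) \<partial>(\<Pi>\<^sub>M b\<in>(Basis :: (real ^ 'd) set). lborel))"
    unfolding comp by (simp add: Basis prod.reindex inj inv_f_f[OF inj])
  also have "\<dots> = (\<Prod>b\<in>Basis. integral\<^sup>L lborel (?g b))"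
    by (rule product_integral_prod) (auto intro: assms)
  also have "\<dots> = (\<Prod>i\<in>UNIV. integral\<^sup>L lborel (f i))"
    by (simp add: Basis prod.reindex inj inv_f_f[OF inj])
  finally show ?thesis .
qed

lemma integral_torus_character:
  fixes k :: "real ^ 'd::finite"
  assumes "k \<in> integer_lattice"
  shows "(LINT x:torus|lborel. exp (\<i> * complex_of_real (k \<bullet> x))) =
    (if k = 0 then complex_of_real ((2 * pi) ^ CARD('d)) else 0)"
proof -
  let ?f = "\<lambda>i t. indicator {-pi<..pi} t *\<^sub>R exp (\<i> * complex_of_real (k $ i * t))"
  have int: "integrable lborel (?f i)" for i
    by (rule integrableI_bounded_set_indicator[where B = 1]) auto
  have prod: "indicator torus x *\<^sub>R exp (\<i> * complex_of_real (k \<bullet> x)) = (\<Prod>i\<in>UNIV. ?f i (x $ i))" for x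
  proof (cases "x \<in> torus")
    case True
    then show ?thesis
      by (simp add: torus_def inner_vec_def sum_distrib_left exp_sum)
  next
    case False
    then obtain i where "\<not> (- pi < x $ i \<and> x $ i \<le> pi)" by (auto simp: torus_def)
    then have "?f i (x $ i) = 0" by auto
    then have "(\<Prod>i\<in>UNIV. ?f i (x $ i)) = 0" by (intro prod_zero) auto
    then show ?thesis using False by simp
  qed
  have "(LINT x:torus|lborel. exp (\<i> * complex_of_real (k \<bullet> x))) =
      (\<Prod>i\<in>UNIV. LINT t:{-pi<..pi}|lborel. exp (\<i> * complex_of_real (k $ i * t)))"
    unfolding set_lebesgue_integral_def prod by (rule lborel_integral_prod_components[OF int])
  also have "\<dots> = (\<Prod>i\<in>UNIV. if k $ i = 0 then complex_of_real (2 * pi) else 0)"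
    using assms by (intro prod.cong refl integral_circle_character) (simp add: integer_lattice_def)
  also have "\<dots> = (if k = 0 then complex_of_real ((2 * pi) ^ CARD('d)) else 0)"
    by (auto simp: vec_eq_iff intro!: prod_zero)
  finally show ?thesis .
qed

lemma set_integrable_torus:
  fixes f :: "real ^ 'd::finite \<Rightarrow> 'b::euclidean_space"
  assumes "continuous_on UNIV f"
  shows "set_integrable lborel torus f"
proof (rule set_integrable_subset)
  show "set_integrable lborel (cbox (\<chi> i. -pi) (\<chi> i. pi)) f"
    unfolding set_integrable_def
    by (rule borel_integrable_compact) (auto intro: continuous_on_subset[OF assms])
  show "(torus :: (real ^ 'd) set) \<in> sets lborel"
    unfolding torus_def by measurable
  show "torus \<subseteq> cbox (\<chi> i. -pi) ((\<chi> i. pi) :: real ^ 'd)"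
    by (auto simp: torus_def mem_box_cart less_imp_le)
qed

lemma finite_bounded_integer_lattice:
  fixes W :: "(real ^ 'd::finite) set"
  assumes "bounded W"
  shows "finite (W \<inter> integer_lattice)"
proof -
  obtain B where B: "\<And>x. x \<in> W \<Longrightarrow> norm x \<le> B"
    using assms by (auto simp: bounded_iff)
  have "W \<inter> integer_lattice \<subseteq> {x. \<forall>i. x $ i \<in> {k \<in> \<int>. \<bar>k\<bar> \<le> B}}"
    using B component_le_norm_cart order_trans by (fastforce simp: integer_lattice_def)
  also have "\<dots> \<subseteq> vec_lambda ` (PiE UNIV (\<lambda>i. {k \<in> \<int>. \<bar>k\<bar> \<le> B}))"
    by (auto intro!: image_eqI[of _ _ "vec_nth _"])
  finally have "W \<inter> integer_lattice \<subseteq> vec_lambda ` (PiE UNIV (\<lambda>i. {k \<in> \<int>. \<bar>k\<bar> \<le> B}))" .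
  moreover have "finite (vec_lambda ` (PiE (UNIV :: 'd set) (\<lambda>i. {k :: real. k \<in> \<int> \<and> \<bar>k\<bar> \<le> B})))"
    by (intro finite_imageI finite_PiE finite_abs_int_segment) simp
  ultimately show ?thesis by (rule finite_subset)
qed

section \<open>Fourier coefficients of Dirichlet kernels\<close>

lemma continuous_on_dirichlet_kernel: "continuous_on UNIV (dirichlet_kernel W)"
  unfolding dirichlet_kernel_def by (intro continuous_intros)

lemma fourier_coefficient_dirichlet_kernel:
  fixes W :: "(real ^ 'd::finite) set"
  assumes "finite (W \<inter> integer_lattice)" and s: "s \<in> integer_lattice"
  shows "(LINT x:torus|lborel. dirichlet_kernel W x * cnj (exp (\<i> * complex_of_real (s \<bullet> x)))) =
    (if s \<in> W then complex_of_real ((2 * pi) ^ CARD('d)) else 0)"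
proof -
  have "(LINT x:torus|lborel. dirichlet_kernel W x * cnj (exp (\<i> * complex_of_real (s \<bullet> x)))) =
      (LINT x:torus|lborel. \<Sum>k\<in>W \<inter> integer_lattice. exp (\<i> * complex_of_real ((k - s) \<bullet> x)))"
    by (simp add: dirichlet_kernel_def sum_distrib_right exp_cnj inner_diff_left right_diff_distrib
        flip: exp_add)
  also have "\<dots> = (\<Sum>k\<in>W \<inter> integer_lattice. LINT x:torus|lborel. exp (\<i> * complex_of_real ((k - s) \<bullet> x)))"
    unfolding set_lebesgue_integral_def scaleR_sum_right
    by (intro Bochner_Integration.integral_sum set_integrable_torus[unfolded set_integrable_def] continuous_intros)
  also have "\<dots> = (\<Sum>k\<in>W \<inter> integer_lattice. if k = s then complex_of_real ((2 * pi) ^ CARD('d)) else 0)"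
    using s by (intro sum.cong refl, subst integral_torus_character) (auto simp: integer_lattice_def)
  also have "\<dots> = (if s \<in> W then complex_of_real ((2 * pi) ^ CARD('d)) else 0)"
    using assms by simp
  finally show ?thesis .
qed

text \<open>
  The frequencies \<open>s j\<close> may repeat and are counted with multiplicity. The lemma is used for
  \<open>\<bar>h\<bar>\<^sup>2\<close>, with the points of \<open>H\<close> as frequencies, and for \<open>D \<cdot> cnj (h\<^sup>2)\<close>, where the frequencies are the
  sums \<open>a + b\<close> indexed by the pairs \<open>(a, b)\<close>.
\<close>

lemma integral_dirichlet_kernel_times_exponential_sum:
  fixes W :: "(real ^ 'd::finite) set"
  assumes W: "finite (W \<inter> integer_lattice)"
    and s: "\<And>j. j \<in> J \<Longrightarrow> s j \<in> W \<inter> integer_lattice"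
  shows "(LINT x:torus|lborel. dirichlet_kernel W x * cnj (\<Sum>j\<in>J. exp (\<i> * complex_of_real (s j \<bullet> x)))) =
    complex_of_real ((2 * pi) ^ CARD('d) * card J)"
proof -
  have "(LINT x:torus|lborel. dirichlet_kernel W x * cnj (\<Sum>j\<in>J. exp (\<i> * complex_of_real (s j \<bullet> x)))) =
      (\<Sum>j\<in>J. LINT x:torus|lborel. dirichlet_kernel W x * cnj (exp (\<i> * complex_of_real (s j \<bullet> x))))"
    unfolding set_lebesgue_integral_def cnj_sum sum_distrib_left scaleR_sum_right
    by (intro Bochner_Integration.integral_sum set_integrable_torus[unfolded set_integrable_def]
        continuous_intros continuous_on_dirichlet_kernel)
  also have "\<dots> = (\<Sum>j\<in>J. complex_of_real ((2 * pi) ^ CARD('d)))"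
    using s by (intro sum.cong refl, subst fourier_coefficient_dirichlet_kernel[OF W]) auto
  finally show ?thesis by simp
qed

section \<open>The lower bound\<close>

text \<open>
  Integrated against a probability density under which \<open>u\<close> has mean at least \<open>m\<close>, this inequality is
  Jensen's inequality for \<open>x \<mapsto> x powr p\<close>: the linear term contributes a nonnegative amount. The endpoint
  \<open>u = 0\<close>, which occurs at the zeros of the Dirichlet kernel, lies outside the open interval where
  the power is differentiated.
\<close>

lemma powr_above_tangent:
  fixes u m p :: real
  assumes "0 \<le> u" "0 < m" "1 \<le> p"
  shows "m powr p + p * m powr (p - 1) * (u - m) \<le> u powr p"
proof (cases "u = 0")
  case True
  have "m powr p + p * m powr (p - 1) * (u - m) = (1 - p) * m powr p"
    using assms True by (simp add: powr_diff algebra_simps)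
  then show ?thesis using assms True by (simp add: mult_nonpos_nonneg)
next
  case False
  have "p * m powr (p - 1) * (u - m) \<le> u powr p - m powr p"
  proof (rule convex_on_imp_above_tangent[where A = "{0<..}"])
    show "((\<lambda>x. x powr p) has_field_derivative p * m powr (p - 1)) (at m within {0<..})"
      using assms by (auto intro!: derivative_eq_intros simp: powr_diff)
  qed (use assms False powr_convex[of p] in \<open>auto simp: interior_open\<close>)
  then show ?thesis by simp
qed

text \<open>
  The larger a set \<open>H\<close> with \<open>H + H \<subseteq> W\<close> is, the better \<open>\<bar>h\<bar>\<^sup>2\<close> concentrates near the origin, where the
  exponentials of \<open>D\<close> add up without cancellation. The square makes the weight \<open>\<bar>h\<bar>\<^sup>2\<close> nonnegative with an
  integral given exactly by orthogonality, and this turns it into a probability density.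
\<close>

lemma lebesgue_constant_ge_card_powr:
  fixes W H :: "(real ^ 'd::finite) set"
  assumes W: "finite (W \<inter> integer_lattice)"
    and H: "finite H" "H \<noteq> {}" "H \<subseteq> integer_lattice"
    and HH: "\<And>a b. a \<in> H \<Longrightarrow> b \<in> H \<Longrightarrow> a + b \<in> W"
    and p: "1 < p"
  shows "card H powr (1 - 1 / p) \<le> lebesgue_constant p W"
proof -
  define M where "M = real (card H)"
  define C where "C = (2 * pi) ^ CARD('d)"
  let ?D = "dirichlet_kernel W" and ?h = "dirichlet_kernel H"
  have M: "M > 0" using H by (simp add: M_def card_gt_0_iff)
  have C: "C > 0" by (simp add: C_def)
  have h: "?h x = (\<Sum>a\<in>H. exp (\<i> * complex_of_real (a \<bullet> x)))" for x
    using H by (simp add: dirichlet_kernel_def Int_absorb2)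
  have hM: "norm (?h x) \<le> M" for x
    unfolding h M_def using norm_sum[of "\<lambda>a. exp (\<i> * complex_of_real (a \<bullet> x))" H] by simp
  have cont [continuous_intros]: "continuous_on UNIV ?D" "continuous_on UNIV ?h"
    by (rule continuous_on_dirichlet_kernel)+
  have h2: "(?h x)\<^sup>2 = (\<Sum>(a, b)\<in>H \<times> H. exp (\<i> * complex_of_real ((a + b) \<bullet> x)))" for x
    by (simp add: h power2_eq_square sum_product sum.cartesian_product inner_add_left
        distrib_left exp_add)
  have lat: "a + b \<in> integer_lattice" if "a \<in> H" "b \<in> H" for a b
    using that H by (simp add: integer_lattice_def subset_iff)
  have mass: "(LINT x:torus|lborel. norm (?h x) ^ 2) = C * M"
  proof -
    have "complex_of_real (LINT x:torus|lborel. norm (?h x) ^ 2) =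
        (LINT x:torus|lborel. ?h x * cnj (?h x))"
      by (simp add: set_integral_complex_of_real[symmetric] complex_norm_square del: of_real_power)
    also have "\<dots> = complex_of_real (C * M)"
      using integral_dirichlet_kernel_times_exponential_sum[of H H "\<lambda>a. a"] H
      by (auto simp: h C_def M_def)
    finally show ?thesis using of_real_eq_iff by blast
  qed
  have moment: "C * M\<^sup>2 \<le> (LINT x:torus|lborel. norm (?D x) * norm (?h x) ^ 2)"
  proof -
    have "(LINT x:torus|lborel. ?D x * cnj ((?h x)\<^sup>2)) = complex_of_real (C * card (H \<times> H))"
      using integral_dirichlet_kernel_times_exponential_sum[OF W, of "H \<times> H" "\<lambda>(a, b). a + b"] HH lat
      by (auto simp: h2 C_def case_prod_unfold)
    then have "C * M\<^sup>2 = norm (LINT x:torus|lborel. ?D x * cnj ((?h x)\<^sup>2))"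
      using C by (simp add: M_def card_cartesian_product power2_eq_square norm_mult)
    also have "\<dots> \<le> (LINT x:torus|lborel. norm (?D x * cnj ((?h x)\<^sup>2)))"
      by (intro set_integral_norm_bound set_integrable_torus continuous_intros)
    finally show ?thesis by (simp add: norm_mult norm_power)
  qed
  let ?K = "p * M powr (p - 1)"
  have int: "set_integrable lborel torus (\<lambda>x. norm (?D x) powr p)"
    "set_integrable lborel torus (\<lambda>x. norm (?h x) ^ 2)"
    "set_integrable lborel torus (\<lambda>x. norm (?D x) * norm (?h x) ^ 2)"
    using p by (auto intro!: set_integrable_torus continuous_intros continuous_on_powr')
  \<comment> \<open>The tangent inequality at \<open>M\<close>, weighted by \<open>\<bar>h\<bar>\<^sup>2 \<le> M\<^sup>2\<close> and sorted by the two integrals known above.\<close>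
  have pointwise: "(M powr p - ?K * M) * norm (?h x) ^ 2 + ?K * (norm (?D x) * norm (?h x) ^ 2)
      \<le> M\<^sup>2 * norm (?D x) powr p" for x
  proof -
    have "(M powr p - ?K * M) * norm (?h x) ^ 2 + ?K * (norm (?D x) * norm (?h x) ^ 2) =
        (M powr p + ?K * (norm (?D x) - M)) * norm (?h x) ^ 2"
      by (simp add: algebra_simps)
    also have "\<dots> \<le> norm (?D x) powr p * norm (?h x) ^ 2"
      using p M by (intro mult_right_mono powr_above_tangent) auto
    also have "\<dots> \<le> norm (?D x) powr p * M\<^sup>2"
      using hM by (intro mult_left_mono power_mono) auto
    finally show ?thesis by (simp add: mult.commute)
  qed
  define I where "I = (LINT x:torus|lborel. norm (?D x) powr p)"
  have "M powr p * (C * M) \<le> (M powr p - ?K * M) * (C * M) + ?K * (C * M\<^sup>2)"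
    by (simp add: algebra_simps power2_eq_square)
  also have "\<dots> \<le> (M powr p - ?K * M) * (C * M) +
      ?K * (LINT x:torus|lborel. norm (?D x) * norm (?h x) ^ 2)"
    using moment p by (intro add_left_mono mult_left_mono) auto
  also have "\<dots> = (LINT x:torus|lborel.
      (M powr p - ?K * M) * norm (?h x) ^ 2 + ?K * (norm (?D x) * norm (?h x) ^ 2))"
    using int by (simp add: mass)
  also have "\<dots> \<le> (LINT x:torus|lborel. M\<^sup>2 * norm (?D x) powr p)"
    using int pointwise by (intro set_integral_mono set_integral_add set_integrable_mult_right) auto
  also have "\<dots> = M\<^sup>2 * I" by (simp add: I_def)
  finally have "M powr p * (C * M) \<le> M\<^sup>2 * I" .
  then have "M powr (p - 1) \<le> 1 / C * I"
    using M C by (simp add: powr_diff field_simps power2_eq_square)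
  then have "(M powr (p - 1)) powr (1 / p) \<le> (1 / C * I) powr (1 / p)"
    using p by (intro powr_mono2) auto
  moreover have "(p - 1) * (1 / p) = 1 - 1 / p"
    using p by (simp add: field_simps)
  ultimately show ?thesis
    by (simp only: powr_powr lebesgue_constant_def M_def C_def I_def)
qed

theorem theorem5p2:
  fixes p :: real
  assumes "1 < p"
  shows "\<exists>c::real. 0 < c \<and>
    (\<forall>(n :: real ^ 'd::finite) (P :: (real ^ 'd) set).
       (\<forall>j. 1 \<le> n $ j) \<longrightarrow> polyhedron P \<longrightarrow> bounded P \<longrightarrow>
       cbox 0 n \<subseteq> P \<longrightarrow> P \<subseteq> nonneg_orthant \<longrightarrow>
       c * (\<Prod>j\<in>UNIV. (n $ j + 1) powr (1 - 1 / p)) \<le> lebesgue_constant p P)"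
  \<comment> \<open>Each coordinate loses a factor 4: half of the side from \<open>H\<close>, and at most another half from
    replacing \<open>n\<^sub>j\<close> by \<open>n\<^sub>j + 1 \<le> 2 n\<^sub>j\<close>.\<close>
proof (intro exI[of _ "((1 / 4) ^ CARD('d)) powr (1 - 1 / p)"] conjI allI impI)
  fix n :: "real ^ 'd" and P :: "(real ^ 'd) set"
  assume n: "\<forall>j. 1 \<le> n $ j" and P: "bounded P" "cbox 0 n \<subseteq> P"
  define m where "m j = nat \<lfloor>n $ j / 2\<rfloor>" for j
  define H where "H = (\<lambda>f. \<chi> j. real (f j) :: real ^ 'd) ` (PiE UNIV (\<lambda>j. {..m j}))"
  have m: "real (m j) \<le> n $ j / 2" "(n $ j + 1) / 4 \<le> real (m j + 1)" for j
  proof -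
    have "1 \<le> n $ j" using n by blast
    moreover from this have "real (m j) = of_int \<lfloor>n $ j / 2\<rfloor>" by (simp add: m_def)
    moreover have "n $ j / 2 < of_int \<lfloor>n $ j / 2\<rfloor> + 1" "of_int \<lfloor>n $ j / 2\<rfloor> \<le> n $ j / 2"
      by linarith+
    ultimately show "real (m j) \<le> n $ j / 2" "(n $ j + 1) / 4 \<le> real (m j + 1)"
      unfolding of_nat_add of_nat_1 by argo+
  qed
  have "inj_on (\<lambda>f. \<chi> j. real (f j) :: real ^ 'd) A" for A
    by (auto simp: inj_on_def vec_eq_iff)
  then have card: "card H = (\<Prod>j\<in>UNIV. m j + 1)"
    by (simp add: H_def card_image card_PiE)
  have "card H powr (1 - 1 / p) \<le> lebesgue_constant p P"
  proof (rule lebesgue_constant_ge_card_powr)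
    show "finite (P \<inter> integer_lattice)" by (rule finite_bounded_integer_lattice) fact
    show "finite H" "H \<noteq> {}" "H \<subseteq> integer_lattice"
      by (auto simp: H_def finite_PiE PiE_eq_empty_iff integer_lattice_def)
    show "1 < p" by fact
    fix a b assume ab: "a \<in> H" "b \<in> H"
    have half: "0 \<le> x $ j \<and> x $ j \<le> n $ j / 2" if x: "x \<in> H" for x j
    proof -
      obtain f where f: "x = (\<chi> j. real (f j))" and "f \<in> PiE UNIV (\<lambda>j. {..m j})"
        using x unfolding H_def by (elim imageE)
      then have "real (f j) \<le> real (m j)" by (auto simp: PiE_iff)
      then show ?thesis using m(1)[of j] by (simp add: f)
    qed
    have "0 \<le> (a + b) $ j \<and> (a + b) $ j \<le> n $ j" for j
      using half[OF ab(1), of j] half[OF ab(2), of j] by simp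
    then have "a + b \<in> cbox 0 n" by (simp add: mem_box_cart)
    then show "a + b \<in> P" using P by blast
  qed
  moreover have nn: "0 \<le> n $ j + 1" for j
    using n[rule_format, of j] by linarith
  moreover have "(1 / 4) ^ CARD('d) * (\<Prod>j\<in>UNIV. n $ j + 1) \<le> card H"
  proof -
    have "(1 / 4) ^ CARD('d) * (\<Prod>j\<in>UNIV. n $ j + 1) = (\<Prod>j\<in>UNIV. (n $ j + 1) / 4)"
      by (simp add: prod_dividef power_one_over)
    also have "\<dots> \<le> (\<Prod>j\<in>UNIV. real (m j + 1))"
      using m(2) nn by (intro prod_mono) auto
    finally show ?thesis by (simp add: card)
  qed
  ultimately show "((1 / 4) ^ CARD('d)) powr (1 - 1 / p) *
      (\<Prod>j\<in>UNIV. (n $ j + 1) powr (1 - 1 / p)) \<le> lebesgue_constant p P"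
    using assms
      powr_mono2[of "1 - 1 / p" "(1 / 4) ^ CARD('d) * (\<Prod>j\<in>UNIV. n $ j + 1)" "card H"]
    by (simp add: powr_mult prod_powr_distrib prod_nonneg)
qed simp

end
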